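(* Let $x>0$, $\mathtt{k}>0$, $a\in\mathbb{R}$, and $\nu\in\left(|a|-\frac{3\mathtt{k}}{2},\infty\right)$. Then the following reversed Tur\'an type inequality holds: $$\left(\mathcal{L}_{\nu}^{\mathtt{k}}(x)\right)^2-\mathcal{L}_{\nu-a}^{\mathtt{k}}(x)\,\mathcal{L}_{\nu+a}^{\mathtt{k}}(x)\le 0.$$
   Context: For $\mathtt{k}>0$, the $\mathtt{k}$-gamma function is $\Gamma_{\mathtt{k}}(x)=\int_0^\infty t^{x-1}e^{-t^{\mathtt{k}}/\mathtt{k}}\,dt$ for $\Re(x)>0$; $\Gamma$ is the usual gamma function. For real $\nu>-\frac{3\mathtt{k}}{2}$ the normalized modified $\mathtt{k}$-Struve function is $$\mathcal{L}_{\nu}^{\mathtt{k}}(x)=\sum_{r=0}^\infty \frac{\Gamma_{\mathtt{k}}\left(\nu+\frac{3\mathtt{k}}{2}\right)}{\Gamma_{\mathtt{k}}\left(r\mathtt{k}+\nu+\frac{3\mathtt{k}}{2}\right)\Gamma\left(r+\frac32\right)2^{2r+1}}\,x^{2r+1}.$$ *)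

theory Defs
  imports "HOL-Analysis.Analysis"
begin

(* Meaningful for k > 0 and Re x > 0, where the integral converges.  The type 'a can be
   instantiated to real or to complex; for complex x, (of_real t) powr (x - 1) is the
   principal power of t > 0, and the value at the single point t = 0 is immaterial. *)
definition k_Gamma :: "real \<Rightarrow> 'a \<Rightarrow> 'a::{ln, real_normed_field, banach}" where
  "k_Gamma k x = integral {0..} (\<lambda>t::real. of_real t powr (x - 1) * of_real (exp (- (t powr k) / k)))"

(* Meaningful for k > 0 and \<nu> > - 3 k / 2, where the series converges for every x. *)
definition k_Struve :: "real \<Rightarrow> real \<Rightarrow> real \<Rightarrow> real" where
  "k_Struve k \<nu> x =
     (\<Sum>r. k_Gamma k (\<nu> + 3 * k / 2) /
           (k_Gamma k (real r * k + \<nu> + 3 * k / 2) * Gamma (real r + 3 / 2) * 2 ^ (2 * r + 1))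
         * x ^ (2 * r + 1))"

end

theory Submission
  imports Defs
begin

text \<open>
  Put \<open>p = (\<nu> + 3k/2) / k\<close>.  The substitution \<open>u = t powr k / k\<close> expresses the \<open>k\<close>-gamma
  function through the classical one, and the functional equation of \<open>Gamma\<close> then turns the
  quotients of \<open>k\<close>-gamma values in the series into reciprocals of \<open>k ^ r * pochhammer p r\<close>.
  So \<open>k_Struve k \<nu> x\<close> is the sum of \<open>w r / pochhammer p r\<close>, where the weights \<open>w r\<close> are
  positive and do not depend on \<open>\<nu>\<close>.

  Shifting \<open>\<nu>\<close> by \<open>\<plusminus>a\<close> shifts \<open>p\<close> by \<open>\<plusminus>b\<close> with \<open>b = a / k\<close> and \<open>\<bar>b\<bar> < p\<close>.  Each factor of the
  Pochhammer symbol satisfies \<open>(p - b + j) * (p + b + j) = (p + j)\<^sup>2 - b\<^sup>2 \<le> (p + j)\<^sup>2\<close>, so the square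
  of every term of the middle series is at most the product of the corresponding terms of the
  two outer series (\<open>pochhammer_shift_mult_le\<close>).  The Cauchy-Schwarz inequality for series
  (\<open>suminf_square_le_mult\<close>) carries this termwise bound over to the sums.
\<close>

section \<open>The \<open>k\<close>-gamma function in terms of the gamma function\<close>

text \<open>
  The substitution \<open>u = t powr k / k\<close>, with \<open>du = t powr (k - 1) dt\<close>.  It is carried out on the
  open half-line, where this map is differentiable for every \<open>k > 0\<close>; the endpoint is a null set.
\<close>
lemma k_Gamma_eq_Gamma:
  fixes k z :: real
  assumes k: "k > 0" and z: "z > 0"
  shows "k_Gamma k z = k powr (z / k - 1) * Gamma (z / k)"
proof -
  define f where "f = (\<lambda>u::real. k powr (z / k - 1) * (u powr (z / k - 1) / exp u))"
  define g where "g = (\<lambda>t::real. t powr k / k)"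
  have "(f has_integral k powr (z / k - 1) * Gamma (z / k)) {0..}"
    unfolding f_def using k z by (intro has_integral_mult_right Gamma_integral_real) simp
  hence f_int: "(f has_integral k powr (z / k - 1) * Gamma (z / k)) {0<..}"
    by (rule has_integral_spike_set_eq[THEN iffD1, rotated 2])
      (auto intro: negligible_subset[of "{0}"])
  have f_abs: "f absolutely_integrable_on {0<..}"
    using k by (intro nonnegative_absolutely_integrable_1 has_integral_integrable[OF f_int])
      (simp add: f_def)
  have der: "(g has_field_derivative t powr (k - 1)) (at t within {0<..})" if "t \<in> {0<..}" for t
    unfolding g_def using that k by (auto intro!: derivative_eq_intros)
  have inj: "inj_on g {0<..}"
  proof (rule inj_onI)
    fix s t assume "s \<in> {0<..}" "t \<in> {0<..}" "g s = g t"
    thus "s = t"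
      using k powr_less_mono2[of k s t] powr_less_mono2[of k t s]
      by (cases s t rule: linorder_cases) (auto simp: g_def)
  qed
  have img: "g ` {0<..} = {0<..}"
  proof (intro equalityI subsetI)
    fix u :: real assume u: "u \<in> {0<..}"
    have "u = g ((k * u) powr (1 / k))" "(k * u) powr (1 / k) \<in> {0<..}"
      using k u by (auto simp: g_def powr_powr)
    thus "u \<in> g ` {0<..}" by blast
  qed (use k in \<open>auto simp: g_def\<close>)
  have integrand: "\<bar>t powr (k - 1)\<bar> * f (g t) = t powr (z - 1) * exp (- (t powr k) / k)"
    if "t \<in> {0<..}" for t
  proof -
    have "g t powr (z / k - 1) = t powr (z - k) / k powr (z / k - 1)"
      using that k by (simp add: g_def powr_divide powr_powr algebra_simps)
    moreover have "t powr (k - 1) * t powr (z - k) = t powr (z - 1)"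
      by (simp flip: powr_add)
    moreover have "exp (- (t powr k) / k) = 1 / exp (g t)"
      by (simp add: g_def exp_minus field_simps)
    ultimately show ?thesis
      using k by (simp add: f_def)
  qed
  have "k_Gamma k z = integral {0<..} (\<lambda>t. t powr (z - 1) * exp (- (t powr k) / k))"
    unfolding k_Gamma_def of_real_def real_scaleR_def mult_1_right
    by (rule integral_spike_set) (auto intro: negligible_subset[of "{0}"])
  also have "\<dots> = integral {0<..} (\<lambda>t. \<bar>t powr (k - 1)\<bar> * f (g t))"
    by (rule integral_cong) (simp only: integrand)
  also have "\<dots> = k powr (z / k - 1) * Gamma (z / k)"
    using has_absolute_integral_change_of_variables_1'[OF _ der inj,
        of f "k powr (z / k - 1) * Gamma (z / k)"] f_abs f_int img
    by (simp add: integral_unique)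
  finally show ?thesis .
qed

lemma k_Gamma_quotient:
  fixes k z :: real
  assumes k: "k > 0" and z: "z > 0"
  shows "k_Gamma k z / k_Gamma k (real r * k + z) = 1 / (k ^ r * pochhammer (z / k) r)"
proof -
  have "z / k > 0"
    using k z by simp
  hence "z / k \<notin> \<int>\<^sub>\<le>\<^sub>0"
    by (auto elim!: nonpos_Ints_cases' simp del: zero_less_divide_iff)
  hence poch: "pochhammer (z / k) r = Gamma (z / k + real r) / Gamma (z / k)"
    by (rule pochhammer_Gamma)
  have shift: "(real r * k + z) / k = z / k + real r"
    using k by (simp add: field_simps)
  have pow: "k powr (z / k + real r - 1) = k ^ r * k powr (z / k - 1)"
    using k powr_add[of k "real r" "z / k - 1"] by (simp add: powr_realpow algebra_simps)
  have "Gamma (z / k) > 0" "Gamma (z / k + real r) > 0"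
    using k z by (auto intro!: Gamma_real_pos add_pos_nonneg)
  moreover have "real r * k + z > 0"
    using k z by (intro add_nonneg_pos) auto
  ultimately show ?thesis
    using k z by (simp add: k_Gamma_eq_Gamma shift pow poch)
qed

section \<open>The Struve series with Pochhammer denominators\<close>

definition struve_weight :: "real \<Rightarrow> real \<Rightarrow> nat \<Rightarrow> real" where
  "struve_weight k x r = x ^ (2 * r + 1) / (k ^ r * Gamma (real r + 3 / 2) * 2 ^ (2 * r + 1))"

lemma struve_weight_pos:
  assumes "k > 0" "x > 0"
  shows "struve_weight k x r > 0"
  using assms unfolding struve_weight_def
  by (intro divide_pos_pos mult_pos_pos zero_less_power Gamma_real_pos) auto

lemma struve_weight_Suc:
  "struve_weight k x (Suc r) = struve_weight k x r * (x\<^sup>2 / (4 * k * (real r + 3 / 2)))"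
proof -
  have "real r + 3 / 2 \<notin> \<int>\<^sub>\<le>\<^sub>0"
    by (auto elim!: nonpos_Ints_cases')
  hence "Gamma (real (Suc r) + 3 / 2) = (real r + 3 / 2) * Gamma (real r + 3 / 2)"
    using Gamma_plus1[of "real r + 3 / 2"] by (simp add: add_ac)
  thus ?thesis
    by (simp add: struve_weight_def power2_eq_square mult_ac)
qed

lemma k_Struve_eq_suminf:
  fixes k \<nu> x :: real
  assumes k: "k > 0" and nu: "\<nu> + 3 * k / 2 > 0"
  shows "k_Struve k \<nu> x = (\<Sum>r. struve_weight k x r / pochhammer ((\<nu> + 3 * k / 2) / k) r)"
  unfolding k_Struve_def
proof (rule suminf_cong)
  fix r
  let ?G = "k_Gamma k (\<nu> + 3 * k / 2)" and ?Gr = "k_Gamma k (real r * k + \<nu> + 3 * k / 2)"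
  have "?G / (?Gr * Gamma (real r + 3 / 2) * 2 ^ (2 * r + 1)) * x ^ (2 * r + 1)
          = ?G / ?Gr * (x ^ (2 * r + 1) / (Gamma (real r + 3 / 2) * 2 ^ (2 * r + 1)))"
    by simp
  also have "?G / ?Gr = 1 / (k ^ r * pochhammer ((\<nu> + 3 * k / 2) / k) r)"
    using k_Gamma_quotient[OF k nu, of r] by (simp add: add.assoc)
  finally show "?G / (?Gr * Gamma (real r + 3 / 2) * 2 ^ (2 * r + 1)) * x ^ (2 * r + 1)
          = struve_weight k x r / pochhammer ((\<nu> + 3 * k / 2) / k) r"
    by (simp add: struve_weight_def mult_ac)
qed

text \<open>
  The quotient of consecutive terms is \<open>x\<^sup>2 / (4 k (r + 3/2) (p + r))\<close>, which tends to zero.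
\<close>
lemma summable_struve_series:
  fixes k p x :: real
  assumes k: "k > 0" and p: "p > 0" and x: "x > 0"
  shows "summable (\<lambda>r. struve_weight k x r / pochhammer p r)"
proof (rule summable_ratio_test)
  show "(1 / 2 :: real) < 1" by simp
  fix r assume "r \<ge> nat \<lceil>x\<^sup>2 / (2 * k * p)\<rceil>"
  \<comment> \<open>The threshold makes the quotient at most one half, even after \<open>(r + 3/2) (p + r)\<close> is
      replaced by its lower bound \<open>r p\<close>.\<close>
  hence "x\<^sup>2 / (2 * k * p) \<le> real r" by linarith
  hence "x\<^sup>2 \<le> 2 * k * (real r * p)"
    using k p by (simp add: field_simps)
  also have "\<dots> \<le> 2 * k * ((real r + 3 / 2) * (p + real r))"
    using k p by (intro mult_left_mono mult_mono) auto
  also have "\<dots> = 1 / 2 * (4 * k * (real r + 3 / 2) * (p + real r))"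
    by simp
  finally have q: "x\<^sup>2 / (4 * k * (real r + 3 / 2) * (p + real r)) \<le> 1 / 2"
    using k p by (subst pos_divide_le_eq) (auto intro!: mult_pos_pos add_pos_nonneg)
  have term_pos: "struve_weight k x n / pochhammer p n > 0" for n
    using struve_weight_pos[OF k x] pochhammer_pos[OF p] by (rule divide_pos_pos)
  have "struve_weight k x (Suc r) / pochhammer p (Suc r)
      = x\<^sup>2 / (4 * k * (real r + 3 / 2) * (p + real r)) * (struve_weight k x r / pochhammer p r)"
    by (simp add: struve_weight_Suc pochhammer_Suc mult_ac)
  also have "\<dots> \<le> 1 / 2 * (struve_weight k x r / pochhammer p r)"
    using q term_pos[of r] by (intro mult_right_mono) auto
  finally show "norm (struve_weight k x (Suc r) / pochhammer p (Suc r))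
      \<le> 1 / 2 * norm (struve_weight k x r / pochhammer p r)"
    using term_pos[of r] term_pos[of "Suc r"] by (simp only: real_norm_def abs_of_pos)
qed

section \<open>Two inequalities\<close>

text \<open>
  Factor by factor this is \<open>(p + j)\<^sup>2 - b\<^sup>2 \<le> (p + j)\<^sup>2\<close>; the bound on \<open>b\<close> keeps the left-hand
  factors positive, so that the inequalities may be multiplied.
\<close>
lemma pochhammer_shift_mult_le:
  fixes p b :: real
  assumes "\<bar>b\<bar> < p"
  shows "pochhammer (p - b) r * pochhammer (p + b) r \<le> (pochhammer p r)\<^sup>2"
proof (induction r)
  case (Suc r)
  have "(p - b + real r) * (p + b + real r) = (p + real r)\<^sup>2 - b\<^sup>2"
    by (simp add: power2_eq_square algebra_simps)
  hence factor: "(p - b + real r) * (p + b + real r) \<le> (p + real r)\<^sup>2"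
    by simp
  have "pochhammer (p - b) (Suc r) * pochhammer (p + b) (Suc r)
      = (pochhammer (p - b) r * pochhammer (p + b) r) * ((p - b + real r) * (p + b + real r))"
    by (simp add: pochhammer_Suc mult_ac)
  also have "\<dots> \<le> (pochhammer p r)\<^sup>2 * (p + real r)\<^sup>2"
    using assms by (intro mult_mono Suc.IH factor) auto
  finally show ?case
    by (simp add: pochhammer_Suc power_mult_distrib)
qed simp

text \<open>
  The Cauchy-Schwarz inequality applied to \<open>sqrt (B i)\<close> and \<open>sqrt (C i)\<close>: it holds for the
  partial sums and passes to the limit.
\<close>
lemma suminf_square_le_mult:
  fixes A B C :: "nat \<Rightarrow> real"
  assumes sA: "summable A" and sB: "summable B" and sC: "summable C"
    and nonneg: "\<And>i. A i \<ge> 0" "\<And>i. B i \<ge> 0" "\<And>i. C i \<ge> 0"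
    and le: "\<And>i. (A i)\<^sup>2 \<le> B i * C i"
  shows "(suminf A)\<^sup>2 \<le> suminf B * suminf C"
proof (rule LIMSEQ_le)
  show "(\<lambda>n. (\<Sum>i<n. A i)\<^sup>2) \<longlonglongrightarrow> (suminf A)\<^sup>2"
    by (intro tendsto_power summable_LIMSEQ sA)
  show "(\<lambda>n. (\<Sum>i<n. B i) * (\<Sum>i<n. C i)) \<longlonglongrightarrow> suminf B * suminf C"
    by (intro tendsto_mult summable_LIMSEQ sB sC)
  have "(\<Sum>i<n. A i)\<^sup>2 \<le> (\<Sum>i<n. B i) * (\<Sum>i<n. C i)" for n
  proof -
    have "A i \<le> sqrt (B i) * sqrt (C i)" for i
      using real_le_rsqrt[OF le[of i]] by (simp add: real_sqrt_mult)
    hence "(\<Sum>i<n. A i)\<^sup>2 \<le> (\<Sum>i<n. sqrt (B i) * sqrt (C i))\<^sup>2"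
      by (intro power_mono sum_mono sum_nonneg nonneg)
    also have "\<dots> \<le> (\<Sum>i<n. (sqrt (B i))\<^sup>2) * (\<Sum>i<n. (sqrt (C i))\<^sup>2)"
      by (rule Cauchy_Schwarz_ineq_sum)
    finally show ?thesis
      by (simp add: nonneg)
  qed
  thus "\<exists>N. \<forall>n\<ge>N. (\<Sum>i<n. A i)\<^sup>2 \<le> (\<Sum>i<n. B i) * (\<Sum>i<n. C i)"
    by blast
qed

section \<open>The reversed Turan inequality\<close>

theorem mainTheorem2:
  fixes x k a \<nu> :: real
  assumes "x > 0" and "k > 0" and "\<nu> \<in> {\<bar>a\<bar> - 3 * k / 2 <..}"
  shows "(k_Struve k \<nu> x)\<^sup>2 - k_Struve k (\<nu> - a) x * k_Struve k (\<nu> + a) x \<le> 0"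
proof -
  define p b where "p = (\<nu> + 3 * k / 2) / k" and "b = a / k"
  define T where "T = (\<lambda>q r. struve_weight k x r / pochhammer q r)"
  have nu: "\<bar>a\<bar> < \<nu> + 3 * k / 2"
    using assms(3) by simp
  have b: "\<bar>b\<bar> < p"
    using nu assms(2) by (simp add: p_def b_def abs_divide divide_strict_right_mono)
  hence pos: "p > 0" "p - b > 0" "p + b > 0"
    by linarith+
  have shift: "(\<nu> - a + 3 * k / 2) / k = p - b" "(\<nu> + a + 3 * k / 2) / k = p + b"
    by (simp_all add: p_def b_def add_divide_distrib diff_divide_distrib)
  have series: "k_Struve k \<nu> x = suminf (T p)" "k_Struve k (\<nu> - a) x = suminf (T (p - b))"
      "k_Struve k (\<nu> + a) x = suminf (T (p + b))"
    using nu assms(2) k_Struve_eq_suminf[of k \<nu> x] k_Struve_eq_suminf[of k "\<nu> - a" x]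
      k_Struve_eq_suminf[of k "\<nu> + a" x]
    unfolding T_def shift p_def[symmetric] by auto
  have summable: "summable (T q)" if "q > 0" for q
    unfolding T_def using assms(1,2) that by (intro summable_struve_series)
  have nonneg: "T q r \<ge> 0" if "q > 0" for q r
    unfolding T_def
    using struve_weight_pos[OF assms(2,1)] pochhammer_pos[OF that] by (simp add: less_imp_le)
  have "(T p r)\<^sup>2 \<le> T (p - b) r * T (p + b) r" for r
  proof -
    have "(struve_weight k x r)\<^sup>2 / (pochhammer p r)\<^sup>2
        \<le> (struve_weight k x r)\<^sup>2 / (pochhammer (p - b) r * pochhammer (p + b) r)"
      using pochhammer_shift_mult_le[OF b] pos
      by (intro divide_left_mono mult_pos_pos zero_less_power pochhammer_pos) auto
    thus ?thesis
      by (simp add: T_def power_divide power2_eq_square)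
  qed
  hence "(suminf (T p))\<^sup>2 \<le> suminf (T (p - b)) * suminf (T (p + b))"
    using pos by (intro suminf_square_le_mult summable nonneg)
  thus ?thesis
    by (simp add: series)
qed

end
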